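(* There is an absolute constant $C>0$ such that for every integer $N\ge 2$ the expected values $E_N^{\mathrm{rat}}$ and $E_N^{2\text{-adic}}$ of the $N$th rational complexity and of the $N$th $2$-adic complexity over all binary sequences of length $N$ satisfy $$2^{\frac N2-C\frac{N}{\log N}}\le E_N^{\mathrm{rat}}\le 2^{\frac N2+C\frac{N}{\log N}}$$ (that is, $E_N^{\mathrm{rat}}=2^{N/2+O(N/\log N)}$) and $$\left|E_N^{2\text{-adic}}-\frac N2\right|\le C\log N$$ (that is, $E_N^{2\text{-adic}}=\frac N2+O(\log N)$).
   Context: For an integer $N\ge 1$ and a finite binary sequence $\mathcal S^N=(s_0,\dots,s_{N-1})\in\{0,1\}^N$, the $N$th rational complexity is $$\Lambda_{\mathcal S^N}(N)=\min\left\{\max\{|f|,q\}: f,q\in\mathbb Z,\ q>0\text{ odd},\ q\sum_{i=0}^{N-1}s_i2^i\equiv f \bmod 2^N\right\},$$ and the $N$th $2$-adic complexity is $\lambda_{\mathcal S^N}(N)=\log_2\Lambda_{\mathcal S^N}(N)$. The expected values are $$E_N^{\mathrm{rat}}=\frac1{2^N}\sum_{\mathcal S^N\in\{0,1\}^N}\Lambda_{\mathcal S^N}(N),\qquad E_N^{2\text{-adic}}=\frac1{2^N}\sum_{\mathcal S^N\in\{0,1\}^N}\lambda_{\mathcal S^N}(N).$$ Here $\log$ is the natural logarithm. *)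

theory Defs
  imports Complex_Main "HOL-Number_Theory.Cong"
begin

definition binary_seqs :: "nat \<Rightarrow> int list set" where
  "binary_seqs N = {s. length s = N \<and> set s \<subseteq> {0, 1}}"

definition rational_approx :: "int list \<Rightarrow> int \<Rightarrow> int \<Rightarrow> bool" where
  "rational_approx s f q \<longleftrightarrow>
     q > 0 \<and> odd q \<and> [q * (\<Sum>i<length s. s ! i * 2 ^ i) = f] (mod 2 ^ length s)"

text \<open>The order \<open>N\<close> of the complexity is the length of the sequence. The least element is
  taken over the naturals, where it always exists; see \<open>rational_complexity_attained\<close>.\<close>

definition rational_complexity :: "int list \<Rightarrow> nat" where
  "rational_complexity s = (LEAST m. \<exists>f q. rational_approx s f q \<and> int m = max \<bar>f\<bar> q)"

definition two_adic_complexity :: "int list \<Rightarrow> real" where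
  "two_adic_complexity s = log 2 (real (rational_complexity s))"

definition expected_rational :: "nat \<Rightarrow> real" where
  "expected_rational N = 1 / 2 ^ N * (\<Sum>s\<in>binary_seqs N. real (rational_complexity s))"

definition expected_two_adic :: "nat \<Rightarrow> real" where
  "expected_two_adic N = 1 / 2 ^ N * (\<Sum>s\<in>binary_seqs N. two_adic_complexity s)"

lemma rational_complexity_attained:
  "\<exists>f q. rational_approx s f q \<and> int (rational_complexity s) = max \<bar>f\<bar> q"
proof -
  let ?f = "\<Sum>i<length s. s ! i * 2 ^ i"
  have "rational_approx s ?f 1 \<and> int (nat (max \<bar>?f\<bar> 1)) = max \<bar>?f\<bar> 1"
    by (simp add: rational_approx_def)
  then have "\<exists>m f q. rational_approx s f q \<and> int m = max \<bar>f\<bar> q"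
    by blast
  then show ?thesis
    unfolding rational_complexity_def by (rule LeastI_ex)
qed

lemma rational_complexity_le:
  assumes "rational_approx s f q"
  shows "int (rational_complexity s) \<le> max \<bar>f\<bar> q"
proof -
  have "rational_complexity s \<le> nat (max \<bar>f\<bar> q)"
    unfolding rational_complexity_def
    by (rule Least_le, intro exI[of _ f] exI[of _ q]) (use assms in simp)
  then show ?thesis by linarith
qed

end

theory Submission
  imports Defs
begin

text \<open>
  Write \<open>a\<close> for the integer \<open>\<Sum> s\<^sub>i 2\<^sup>i\<close> coded by a binary sequence of length \<open>N\<close>. The pairs
  \<open>(f, q)\<close> with \<open>q a \<equiv> f\<close> modulo \<open>2 ^ N\<close> form a plane lattice of determinant \<open>2 ^ N\<close>, and the
  rational complexity \<open>\<Lambda>\<close> is the least maximum norm of a lattice vector with odd \<open>q\<close>. Dropping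
  the parity condition gives the length \<open>m\<close> of an ordinary shortest vector, which is easier to
  count. The two are tied together by \<open>m \<le> \<Lambda> \<le> 2 ^ N / m + m\<close>
  (\<open>shortest_relation_le_rational_complexity\<close>, \<open>rational_complexity_times_shortest_relation\<close>):
  if the shortest vector has even \<open>q\<close>, then any vector completing it to a lattice basis has an
  odd second coordinate, because the lattice contains \<open>(a, 1)\<close>, and the completing vector can be
  chosen of length about \<open>2 ^ N / m\<close>, as in Minkowski's second theorem.

  All four bounds come from the single estimate that the mean of \<open>1 / m\<close> over all sequences is
  \<open>O(2 ^ (- N / 2))\<close> (\<open>sum_inverse_shortest_relation\<close>). It holds because at most \<open>3 M\<^sup>2\<close> of the
  \<open>2 ^ N\<close> sequences have \<open>m \<le> M\<close> if \<open>M < 2 ^ N\<close> (\<open>card_shortest_relation_le\<close>), while \<open>m\<close> never exceeds about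
  \<open>2 ^ (N / 2)\<close> (\<open>shortest_relation_le_of_square\<close>); a dyadic decomposition turns these two facts
  into the bound for the mean.

  Averaging \<open>\<Lambda> \<le> 2 ^ N / m + m\<close> gives \<open>E \<Lambda> = O(2 ^ (N / 2))\<close>. Concavity of the logarithm gives
  both \<open>E log \<Lambda> \<le> log E \<Lambda>\<close> and \<open>E log \<Lambda> \<ge> E log m = - E log (1 / m) \<ge> - log E (1 / m)\<close>. Hence
  the mean of \<open>log\<^sub>2 \<Lambda>\<close> lies within an additive constant \<open>5\<close> of \<open>N / 2\<close>, the mean of \<open>\<Lambda>\<close> lies
  within a factor \<open>2 ^ 5\<close> of \<open>2 ^ (N / 2)\<close>, and both error terms are smaller than required.
\<close>

section \<open>The shortest relation of either parity\<close>

text \<open>Since \<open>(f, q)\<close> and \<open>(- f, - q)\<close> are equally long, only \<open>q = 0\<close> is lost by asking for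
  \<open>q > 0\<close>; nonzero vectors of that kind have length at least \<open>2 ^ N\<close>, so for short vectors this is the first
  successive minimum of the lattice in the maximum norm.\<close>
definition shortest_relation :: "nat \<Rightarrow> int \<Rightarrow> nat" where
  "shortest_relation N a =
     (LEAST m. \<exists>f q. q > 0 \<and> [q * a = f] (mod 2 ^ N) \<and> int m = max \<bar>f\<bar> q)"

lemma shortest_relation_attained:
  obtains f q where "q > 0" "[q * a = f] (mod 2 ^ N)" "int (shortest_relation N a) = max \<bar>f\<bar> q"
proof -
  have "(1::int) > 0 \<and> [1 * a = a] (mod 2 ^ N) \<and> int (nat (max \<bar>a\<bar> 1)) = max \<bar>a\<bar> 1"
    by simp
  then have "\<exists>m f q. q > 0 \<and> [q * a = f] (mod 2 ^ N) \<and> int m = max \<bar>f\<bar> q"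
    by blast
  then have "\<exists>f q. q > 0 \<and> [q * a = f] (mod 2 ^ N) \<and> int (shortest_relation N a) = max \<bar>f\<bar> q"
    unfolding shortest_relation_def by (rule LeastI_ex)
  then show thesis using that by blast
qed

lemma shortest_relation_le:
  assumes "q > 0" "[q * a = f] (mod 2 ^ N)"
  shows "int (shortest_relation N a) \<le> max \<bar>f\<bar> q"
proof -
  have "shortest_relation N a \<le> nat (max \<bar>f\<bar> q)"
    unfolding shortest_relation_def
    by (rule Least_le, intro exI[of _ f] exI[of _ q]) (use assms in simp)
  then show ?thesis using assms by linarith
qed

lemma shortest_relation_pos: "shortest_relation N a > 0"
proof -
  obtain f q where "q > 0" "int (shortest_relation N a) = max \<bar>f\<bar> q"
    by (rule shortest_relation_attained)
  then show ?thesis by linarith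
qed

text \<open>In the lattice basis \<open>(a, 1)\<close>, \<open>(2 ^ N, 0)\<close> the vector \<open>(f, q)\<close> has coordinates \<open>q\<close> and \<open>k\<close>.
  A common factor of the coordinates could be divided out, leaving a shorter vector. Primitivity
  is what allows the vector to be completed to a basis.\<close>
lemma shortest_relation_primitive:
  assumes "q > 0" and f: "f = q * a + 2 ^ N * k"
    and min: "int (shortest_relation N a) = max \<bar>f\<bar> q"
  shows "coprime q k"
proof (rule ccontr)
  assume "\<not> coprime q k"
  define d where "d = gcd q k"
  have "d > 0" "d \<noteq> 1"
    using \<open>q > 0\<close> \<open>\<not> coprime q k\<close> by (auto simp: d_def coprime_iff_gcd_eq_1)
  then have "d \<ge> 2" by linarith
  obtain q' k' where q': "q = d * q'" and k': "k = d * k'"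
    unfolding d_def by (metis dvdE gcd_dvd1 gcd_dvd2)
  define f' where "f' = q' * a + 2 ^ N * k'"
  have ff': "f = d * f'"
    by (simp add: f f'_def q' k' algebra_simps)
  have "q' > 0" using \<open>q > 0\<close> \<open>d > 0\<close> by (simp add: q' zero_less_mult_iff)
  moreover have "[q' * a = f'] (mod 2 ^ N)"
    by (simp add: f'_def cong_def)
  ultimately have "int (shortest_relation N a) \<le> max \<bar>f'\<bar> q'"
    by (rule shortest_relation_le)
  moreover have "max \<bar>f\<bar> q = d * max \<bar>f'\<bar> q'"
    using \<open>d > 0\<close> by (simp add: ff' q' abs_mult max_mult_distrib_left)
  moreover have "2 * (max \<bar>f'\<bar> q') \<le> d * (max \<bar>f'\<bar> q')"
    using \<open>d \<ge> 2\<close> \<open>q' > 0\<close> by (intro mult_right_mono) auto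
  ultimately show False using min \<open>q' > 0\<close> by linarith
qed

section \<open>From the shortest relation to one with odd denominator\<close>

text \<open>Adding a multiple of \<open>(f, q)\<close> to \<open>(c, b)\<close> does not change the determinant \<open>n\<close>. Division with
  remainder makes the coordinate in which \<open>(f, q)\<close> attains its norm \<open>m\<close> at most \<open>m\<close>, and the
  determinant equation then bounds the other coordinate by \<open>n / m + m\<close>.\<close>
lemma short_complementary_vector:
  fixes f q n :: int
  assumes det: "c * q - b * f = n" and "n \<ge> 0" and "q > 0"
  shows "\<exists>t. max \<bar>c - t * f\<bar> \<bar>b - t * q\<bar> * max \<bar>f\<bar> q \<le> n + (max \<bar>f\<bar> q)\<^sup>2"
proof -
  define m where "m = max \<bar>f\<bar> q"
  have "m > 0" "\<bar>f\<bar> \<le> m" "q \<le> m" using \<open>q > 0\<close> by (auto simp: m_def)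
  have det': "(c - t * f) * q - (b - t * q) * f = n" for t
    using det by (simp add: algebra_simps)
  have goal: "max \<bar>x\<bar> \<bar>y\<bar> * m \<le> n + m\<^sup>2"
    if "\<bar>x\<bar> * m \<le> n + m\<^sup>2" "\<bar>y\<bar> * m \<le> n + m\<^sup>2" for x y :: int
    using that by (simp add: max_def)
  show ?thesis
  proof (cases "\<bar>f\<bar> \<le> q")
    case True
    then have "q = m" by (simp add: m_def)
    define t where "t = b div q"
    have b: "b - t * q = b mod q" by (simp add: t_def minus_div_mult_eq_mod)
    then have bound: "\<bar>b - t * q\<bar> \<le> m"
      using \<open>q > 0\<close> \<open>q = m\<close> pos_mod_bound[of q b] pos_mod_sign[of q b] by linarith
    then have 1: "\<bar>b - t * q\<bar> * m \<le> n + m\<^sup>2"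
      using \<open>n \<ge> 0\<close> \<open>m > 0\<close> mult_right_mono[OF bound, of m]
      unfolding power2_eq_square by linarith
    have "(c - t * f) * m = n + (b - t * q) * f"
      using det'[of t] \<open>q = m\<close> by simp
    then have "\<bar>c - t * f\<bar> * m = \<bar>n + (b - t * q) * f\<bar>"
      using \<open>m > 0\<close> by (metis abs_mult abs_of_pos)
    also have "\<dots> \<le> n + \<bar>b - t * q\<bar> * \<bar>f\<bar>"
      using \<open>n \<ge> 0\<close> abs_triangle_ineq[of n "(b - t * q) * f"] by (simp add: abs_mult)
    also have "\<dots> \<le> n + m\<^sup>2"
      using mult_mono[OF bound \<open>\<bar>f\<bar> \<le> m\<close>] \<open>m > 0\<close> by (simp add: power2_eq_square)
    finally show ?thesis using goal 1 unfolding m_def by blast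
  next
    case False
    then have "\<bar>f\<bar> = m" "f \<noteq> 0" using \<open>q > 0\<close> by (auto simp: m_def)
    define t where "t = c div f"
    have c: "c - t * f = c mod f" by (simp add: t_def minus_div_mult_eq_mod)
    then have bound: "\<bar>c - t * f\<bar> \<le> m"
      using \<open>f \<noteq> 0\<close> \<open>\<bar>f\<bar> = m\<close> abs_mod_less[of f c] by linarith
    then have 1: "\<bar>c - t * f\<bar> * m \<le> n + m\<^sup>2"
      using \<open>n \<ge> 0\<close> \<open>m > 0\<close> mult_right_mono[OF bound, of m]
      unfolding power2_eq_square by linarith
    have "\<bar>b - t * q\<bar> * m = \<bar>(c - t * f) * q - n\<bar>"
      using det'[of t] by (simp flip: \<open>\<bar>f\<bar> = m\<close> abs_mult)
    also have "\<dots> \<le> n + \<bar>c - t * f\<bar> * q"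
      using \<open>n \<ge> 0\<close> \<open>q > 0\<close> abs_triangle_ineq4[of "(c - t * f) * q" n] by (simp add: abs_mult)
    also have "\<dots> \<le> n + m\<^sup>2"
      using mult_mono[OF bound \<open>q \<le> m\<close>] \<open>m > 0\<close> \<open>q > 0\<close> by (simp add: power2_eq_square)
    finally show ?thesis using goal 1 unfolding m_def by blast
  qed
qed

definition seq_value :: "int list \<Rightarrow> int" where
  "seq_value s = (\<Sum>i<length s. s ! i * 2 ^ i)"

lemma shortest_relation_le_rational_complexity:
  "shortest_relation (length s) (seq_value s) \<le> rational_complexity s"
proof -
  obtain f q where "rational_approx s f q" "int (rational_complexity s) = max \<bar>f\<bar> q"
    using rational_complexity_attained by blast
  then show ?thesis
    using shortest_relation_le[of q "seq_value s" f "length s"]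
    by (simp add: rational_approx_def seq_value_def)
qed

text \<open>A shortest vector with odd \<open>q\<close> shows \<open>\<Lambda> \<le> m\<close>. If \<open>q\<close> is even, Bezout's identity
  \<open>l q - b k = 1\<close> for its basis coordinates \<open>(q, k)\<close> forces \<open>b\<close> to be odd, and it stays odd when
  multiples of \<open>q\<close> are subtracted. So the reduced complementary vector has odd denominator.\<close>
lemma rational_complexity_times_shortest_relation:
  fixes s :: "int list"
  defines "m \<equiv> int (shortest_relation (length s) (seq_value s))"
  shows "int (rational_complexity s) * m \<le> 2 ^ length s + m\<^sup>2"
proof -
  let ?a = "seq_value s" and ?n = "2 ^ length s :: int"
  have "m > 0" using shortest_relation_pos by (simp add: m_def)
  obtain f q where "q > 0" and cong: "[q * ?a = f] (mod ?n)" and m: "m = max \<bar>f\<bar> q"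
    unfolding m_def by (rule shortest_relation_attained)
  show ?thesis
  proof (cases "even q")
    case False
    then have "int (rational_complexity s) \<le> m"
      using \<open>q > 0\<close> cong rational_complexity_le[of s f q]
      by (simp add: rational_approx_def seq_value_def m)
    then have "int (rational_complexity s) * m \<le> m * m"
      using \<open>m > 0\<close> by (intro mult_right_mono) auto
    then show ?thesis by (simp add: power2_eq_square add_increasing)
  next
    case True
    obtain k where f: "f = q * ?a + ?n * k"
      using cong by (metis cong_iff_lin)
    have "coprime q k"
      using shortest_relation_primitive[OF \<open>q > 0\<close> f] m by (simp add: m_def)
    then obtain l b' where "l * q + b' * k = 1"
      by (metis bezout_int coprime_iff_gcd_eq_1)
    then obtain b where bez: "l * q - b * k = 1" by (metis diff_minus_eq_add mult_minus_left)
    then have "odd b" using True by (metis dvd_diff dvd_mult dvd_mult2 odd_one)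
    define c where "c = b * ?a + ?n * l"
    have "c * q - b * f = ?n * (l * q - b * k)"
      by (simp add: c_def f algebra_simps)
    then have "c * q - b * f = ?n" by (simp add: bez)
    then obtain t where t: "max \<bar>c - t * f\<bar> \<bar>b - t * q\<bar> * m \<le> ?n + m\<^sup>2"
      using short_complementary_vector[of c q b f ?n] \<open>q > 0\<close> m by auto
    \<comment> \<open>The sign is normalised so that the denominator becomes positive.\<close>
    define x y where "x = sgn (b - t * q) * (c - t * f)" and "y = \<bar>b - t * q\<bar>"
    have "odd (b - t * q)" using \<open>odd b\<close> True by simp
    then have "odd y" "y > 0" "b - t * q \<noteq> 0" by (auto simp: y_def)
    have "c - t * f = (b - t * q) * ?a + ?n * (l - t * k)"
      by (simp add: c_def f algebra_simps)
    then have "x = (b - t * q) * sgn (b - t * q) * ?a + ?n * (sgn (b - t * q) * (l - t * k))"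
      unfolding x_def by (simp only: distrib_left mult_ac)
    then have "x = y * ?a + ?n * (sgn (b - t * q) * (l - t * k))"
      by (simp only: y_def abs_sgn)
    then have "[y * ?a = x] (mod ?n)" by (simp add: cong_def)
    then have "rational_approx s x y"
      using \<open>odd y\<close> \<open>y > 0\<close> by (simp add: rational_approx_def seq_value_def)
    then have "int (rational_complexity s) \<le> max \<bar>x\<bar> y"
      by (rule rational_complexity_le)
    also have "max \<bar>x\<bar> y = max \<bar>c - t * f\<bar> \<bar>b - t * q\<bar>"
      using \<open>b - t * q \<noteq> 0\<close> by (simp add: x_def y_def abs_mult abs_sgn_eq)
    finally have "int (rational_complexity s) * m \<le> max \<bar>c - t * f\<bar> \<bar>b - t * q\<bar> * m"
      using \<open>m > 0\<close> by (intro mult_right_mono) auto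
    then show ?thesis using t by linarith
  qed
qed

section \<open>Bounds for the shortest relation\<close>

text \<open>Pigeonhole: there are more pairs in the box \<open>[0, K]\<^sup>2\<close> than residues of \<open>x a - y\<close>, and the
  difference of two colliding pairs is a relation of length at most \<open>K\<close>. The bound \<open>K < 2 ^ N\<close>
  rules out a collision between pairs with the same \<open>x\<close>.\<close>
lemma shortest_relation_le_of_square:
  fixes K :: int
  assumes "2 ^ N < (K + 1)\<^sup>2" and "0 \<le> K" and "K < 2 ^ N"
  shows "int (shortest_relation N a) \<le> K"
proof -
  let ?h = "\<lambda>(x, y). (x * a - y) mod 2 ^ N"
  let ?B = "{0..K} \<times> {0..K}"
  have "?h ` ?B \<subseteq> {0..<2 ^ N}" by auto
  then have "card (?h ` ?B) \<le> card {0..<2 ^ N :: int}"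
    by (intro card_mono) auto
  moreover have "int (card ?B) = (K + 1)\<^sup>2"
    using \<open>0 \<le> K\<close> by (simp add: card_cartesian_product power2_eq_square)
  moreover have "int (card {0..<2 ^ N :: int}) = 2 ^ N" by simp
  ultimately have "int (card (?h ` ?B)) < int (card ?B)"
    using assms(1) by linarith
  then have "card (?h ` ?B) < card ?B" by (simp only: of_nat_less_iff)
  then have "\<not> inj_on ?h ?B" by (rule pigeonhole)
  then obtain x y x' y' where box: "{x, y, x', y'} \<subseteq> {0..K}"
    and ne: "(x, y) \<noteq> (x', y')"
    and eq: "(x * a - y) mod 2 ^ N = (x' * a - y') mod 2 ^ N"
    and "x' \<le> x"
    by (smt (verit) SigmaE case_prod_conv empty_subsetI inj_onI insert_subset)
  from eq have "2 ^ N dvd (x * a - y) - (x' * a - y')"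
    by (simp add: mod_eq_dvd_iff)
  then have dvd: "2 ^ N dvd (x - x') * a - (y - y')"
    by (simp add: algebra_simps)
  have "\<bar>y - y'\<bar> \<le> K" "x - x' \<le> K" using box by auto
  have "x \<noteq> x'"
  proof
    assume "x = x'"
    then have "2 ^ N dvd y - y'" using dvd dvd_minus_iff[of "2 ^ N" "y - y'"] by simp
    then have "y - y' = 0"
      using dvd_imp_le_int[of "y - y'" "2 ^ N"] \<open>\<bar>y - y'\<bar> \<le> K\<close> \<open>K < 2 ^ N\<close> by fastforce
    then show False using ne \<open>x = x'\<close> by simp
  qed
  then have "x - x' > 0" using \<open>x' \<le> x\<close> by simp
  moreover have "[(x - x') * a = y - y'] (mod 2 ^ N)"
    using dvd by (simp add: cong_iff_dvd_diff)
  ultimately have "int (shortest_relation N a) \<le> max \<bar>y - y'\<bar> (x - x')"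
    by (rule shortest_relation_le)
  then show ?thesis using \<open>\<bar>y - y'\<bar> \<le> K\<close> \<open>x - x' \<le> K\<close> by linarith
qed

text \<open>Let \<open>2 ^ k\<close> be the exact power of two in \<open>q\<close>. Multiplication by \<open>q\<close> modulo \<open>2 ^ N\<close> is
  \<open>2 ^ k\<close> to one, but it only takes multiples of \<open>2 ^ k\<close> as values, and about \<open>2 M / 2 ^ k\<close> of these
  lie in \<open>[- M, M]\<close>. So even denominators do not lose anything essential: the count is at most
  \<open>2 M + 2 ^ k\<close>, and \<open>2 ^ k \<le> q \<le> M\<close>.\<close>
lemma card_small_multiples_le:
  fixes q M :: int
  assumes "0 < q" "q \<le> M" "M < 2 ^ N"
  shows "int (card {a \<in> {0..<2 ^ N}. \<exists>f. \<bar>f\<bar> \<le> M \<and> [q * a = f] (mod 2 ^ N)}) \<le> 3 * M"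
    (is "int (card ?A) \<le> _")
proof -
  define k where "k = multiplicity 2 q"
  obtain r where r: "q = 2 ^ k * r" "odd r"
    using \<open>0 < q\<close> multiplicity_decompose'[of q 2] unfolding k_def by auto
  have "r \<ge> 1" using \<open>0 < q\<close> r by (simp add: zero_less_mult_iff)
  then have "2 ^ k \<le> q" by (simp add: r(1))
  then have "2 ^ k < (2 ^ N :: int)" using assms by linarith
  then have "k < N" by simp
  then have pow: "(2 ^ N :: int) = 2 ^ k * 2 ^ (N - k)" by (simp flip: power_add)
  obtain F where F: "\<And>a. a \<in> ?A \<Longrightarrow> \<bar>F a\<bar> \<le> M \<and> [q * a = F a] (mod 2 ^ N)"
    using bchoice[of ?A "\<lambda>a f. \<bar>f\<bar> \<le> M \<and> [q * a = f] (mod 2 ^ N)"] by blast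
  have Fdvd: "2 ^ k dvd F a" if "a \<in> ?A" for a
  proof -
    have "2 ^ N dvd q * a - F a"
      using F[OF that] by (simp add: cong_iff_dvd_diff)
    then have "2 ^ k dvd q * a - F a" by (metis dvd_mult_left pow)
    moreover have "2 ^ k dvd q * a" by (simp add: r(1))
    ultimately show ?thesis using dvd_diff[of "2 ^ k" "q * a" "q * a - F a"] by simp
  qed
  let ?h = "\<lambda>a. (F a div 2 ^ k, a div 2 ^ (N - k))"
  let ?D = "M div 2 ^ k"
  \<comment> \<open>The value \<open>F a\<close> determines \<open>a\<close> modulo \<open>2 ^ (N - k)\<close>; the quotient supplies the top \<open>k\<close> bits.\<close>
  have "inj_on ?h ?A"
  proof (rule inj_onI)
    fix a b assume ab: "a \<in> ?A" "b \<in> ?A" and eq: "?h a = ?h b"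
    then have "F a = F b" 
      using Fdvd[OF ab(1)] Fdvd[OF ab(2)] by (metis dvd_mult_div_cancel prod.inject)
    then have "[q * a = q * b] (mod 2 ^ N)"
      using F[OF ab(1)] F[OF ab(2)] by (metis cong_sym cong_trans)
    then have "2 ^ N dvd q * a - q * b" by (simp add: cong_iff_dvd_diff)
    then have "2 ^ k * 2 ^ (N - k) dvd 2 ^ k * (r * (a - b))"
      by (simp add: pow r(1) algebra_simps)
    then have "2 ^ (N - k) dvd r * (a - b)" by simp
    moreover have "coprime (2 ^ (N - k)) r" using r(2) by simp
    ultimately have "2 ^ (N - k) dvd a - b" by (metis coprime_dvd_mult_right_iff)
    then have "a mod 2 ^ (N - k) = b mod 2 ^ (N - k)" by (simp add: mod_eq_dvd_iff)
    moreover have "a div 2 ^ (N - k) = b div 2 ^ (N - k)" using eq by simp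
    ultimately show "a = b" by (metis div_mult_mod_eq)
  qed
  moreover have "?h ` ?A \<subseteq> {- ?D..?D} \<times> {0..<2 ^ k}"
  proof (rule image_subsetI)
    fix a assume a: "a \<in> ?A"
    then obtain g where g: "F a = 2 ^ k * g" using Fdvd by (meson dvdE)
    then have "2 ^ k * \<bar>g\<bar> \<le> M" using F[OF a] by (simp add: abs_mult)
    then have "\<bar>g\<bar> \<le> ?D" using zdiv_mono1[of "2 ^ k * \<bar>g\<bar>" M "2 ^ k"] by simp
    moreover have "0 \<le> a div 2 ^ (N - k)"
      using a by (simp add: pos_imp_zdiv_nonneg_iff)
    moreover have "a div 2 ^ (N - k) * 2 ^ (N - k) < 2 ^ k * 2 ^ (N - k)"
    proof -
      have "0 \<le> a mod 2 ^ (N - k)" by simp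
      moreover have "a < 2 ^ k * 2 ^ (N - k)" using a by (auto simp flip: pow)
      ultimately show ?thesis using div_mult_mod_eq[of a "2 ^ (N - k)"] by linarith
    qed
    then have "a div 2 ^ (N - k) < 2 ^ k" by simp
    ultimately show "?h a \<in> {- ?D..?D} \<times> {0..<2 ^ k}" using g by auto
  qed
  ultimately have "card ?A \<le> card ({- ?D..?D} \<times> {0..<2 ^ k :: int})"
    by (intro card_inj_on_le) auto
  moreover have "?D \<ge> 0" using assms by (simp add: pos_imp_zdiv_nonneg_iff)
  then have "int (card ({- ?D..?D} \<times> {0..<2 ^ k :: int})) = (2 * ?D + 1) * 2 ^ k"
    by (simp add: card_cartesian_product)
  ultimately have "int (card ?A) \<le> (2 * ?D + 1) * 2 ^ k" by linarith
  also have "\<dots> = 2 * (?D * 2 ^ k) + 2 ^ k" by (simp add: algebra_simps)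
  also have "?D * 2 ^ k \<le> M"
  proof -
    have "0 \<le> M mod 2 ^ k" by simp
    then show ?thesis using div_mult_mod_eq[of M "2 ^ k"] by linarith
  qed
  also have "2 ^ k \<le> M" using \<open>2 ^ k \<le> q\<close> assms by simp
  finally show ?thesis by simp
qed

lemma card_shortest_relation_le:
  assumes "M < 2 ^ N"
  shows "card {a \<in> {0..<2 ^ N}. shortest_relation N a \<le> M} \<le> 3 * M\<^sup>2"
proof -
  let ?S = "\<lambda>q. {a \<in> {0..<2 ^ N}. \<exists>f. \<bar>f\<bar> \<le> int M \<and> [q * a = f] (mod 2 ^ N)}"
  have M: "int M < 2 ^ N" using assms by (metis of_nat_less_iff of_nat_numeral of_nat_power)
  have "{a \<in> {0..<2 ^ N}. shortest_relation N a \<le> M} \<subseteq> (\<Union>q\<in>{1..int M}. ?S q)"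
  proof
    fix a assume a: "a \<in> {a \<in> {0..<2 ^ N}. shortest_relation N a \<le> M}"
    obtain f q where "q > 0" "[q * a = f] (mod 2 ^ N)" "int (shortest_relation N a) = max \<bar>f\<bar> q"
      by (rule shortest_relation_attained)
    then show "a \<in> (\<Union>q\<in>{1..int M}. ?S q)"
      using a by (intro UN_I[of q]) (auto intro!: exI[of _ f])
  qed
  then have "card {a \<in> {0..<2 ^ N}. shortest_relation N a \<le> M} \<le> card (\<Union>q\<in>{1..int M}. ?S q)"
    by (intro card_mono finite_UN_I finite_subset[of "?S _" "{0..<2 ^ N}"]) auto
  also have "\<dots> \<le> (\<Sum>q\<in>{1..int M}. card (?S q))"
    by (intro card_UN_le) auto
  also have "\<dots> \<le> (\<Sum>q\<in>{1..int M}. 3 * M)"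
  proof (rule sum_mono)
    fix q assume "q \<in> {1..int M}"
    then have "int (card (?S q)) \<le> 3 * int M"
      using M by (intro card_small_multiples_le) auto
    then show "card (?S q) \<le> 3 * M" by linarith
  qed
  also have "\<dots> = 3 * M\<^sup>2" by (simp add: power2_eq_square)
  finally show ?thesis .
qed

section \<open>Binary sequences as integers\<close>

lemma seq_value_Nil: "seq_value [] = 0"
  by (simp add: seq_value_def)

lemma seq_value_Cons: "seq_value (x # s) = x + 2 * seq_value s"
  unfolding seq_value_def length_Cons sum.lessThan_Suc_shift
  by (simp add: sum_distrib_left mult_ac)

lemma finite_binary_seqs: "finite (binary_seqs N)"
  using finite_lists_length_eq[of "{0, 1 :: int}" N]
  by (simp add: binary_seqs_def conj_commute)

lemma card_binary_seqs: "card (binary_seqs N) = 2 ^ N"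
  using card_lists_length_eq[of "{0, 1 :: int}" N]
  by (simp add: binary_seqs_def conj_commute numeral_2_eq_2)

lemma seq_value_range: "set s \<subseteq> {0, 1} \<Longrightarrow> seq_value s \<in> {0..<2 ^ length s}"
proof (induction s)
  case Nil
  then show ?case by (simp add: seq_value_Nil)
next
  case (Cons x s)
  then show ?case by (auto simp: seq_value_Cons)
qed

lemma seq_value_inject:
  assumes "length s = length s'" "set s \<subseteq> {0, 1}" "set s' \<subseteq> {0, 1}" "seq_value s = seq_value s'"
  shows "s = s'"
  using assms
proof (induction s s' rule: list_induct2)
  case Nil
  then show ?case by simp
next
  case (Cons x s x' s')
  then have eq: "x + 2 * seq_value s = x' + 2 * seq_value s'"
    by (simp add: seq_value_Cons)
  have "x = 0 \<or> x = 1" "x' = 0 \<or> x' = 1" using Cons.prems by auto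
  with eq have "x = x' \<and> seq_value s = seq_value s'" by presburger
  then show ?case using Cons by auto
qed

text \<open>Binary expansion is injective into the integers below \<open>2 ^ N\<close>, which transfers the count from
  residues to sequences.\<close>

lemma card_binary_seqs_shortest_relation_le:
  assumes "M < 2 ^ N"
  shows "card {s \<in> binary_seqs N. shortest_relation N (seq_value s) \<le> M} \<le> 3 * M\<^sup>2"
proof -
  have "card {s \<in> binary_seqs N. shortest_relation N (seq_value s) \<le> M}
      \<le> card {a \<in> {0..<2 ^ N}. shortest_relation N a \<le> M}"
  proof (rule card_inj_on_le)
    show "inj_on seq_value {s \<in> binary_seqs N. shortest_relation N (seq_value s) \<le> M}"
      by (rule inj_onI) (auto simp: binary_seqs_def intro: seq_value_inject)
    show "seq_value ` {s \<in> binary_seqs N. shortest_relation N (seq_value s) \<le> M}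
        \<subseteq> {a \<in> {0..<2 ^ N}. shortest_relation N a \<le> M}"
      using seq_value_range by (auto simp: binary_seqs_def)
    show "finite {a \<in> {0..<2 ^ N}. shortest_relation N a \<le> M}"
      by (rule finite_subset[of _ "{0..<2 ^ N}"]) auto
  qed
  also have "\<dots> \<le> 3 * M\<^sup>2" using assms by (rule card_shortest_relation_le)
  finally show ?thesis .
qed

section \<open>The mean of the reciprocal\<close>

text \<open>The term of the least \<open>j\<close> with \<open>m \<le> 2 ^ j\<close> suffices, since \<open>2 ^ j \<le> 2 m\<close> for it. The sum
  has the advantage that its mean only involves the numbers of sequences with \<open>m \<le> 2 ^ j\<close>.\<close>
lemma inverse_le_dyadic_sum:
  fixes m :: nat
  assumes "0 < m" "m \<le> 2 ^ J"
  shows "1 / real m \<le> (\<Sum>j\<le>J. 2 / 2 ^ j * of_bool (m \<le> 2 ^ j))"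
proof -
  define i where "i = (LEAST j. m \<le> 2 ^ j)"
  have "m \<le> 2 ^ i" unfolding i_def using assms(2) by (rule LeastI)
  have "i \<le> J" unfolding i_def using assms(2) by (rule Least_le)
  have "2 ^ i \<le> 2 * m"
  proof (cases i)
    case (Suc l)
    then have "\<not> m \<le> 2 ^ l" using not_less_Least[of l "\<lambda>j. m \<le> 2 ^ j"] by (simp add: i_def)
    then show ?thesis by (simp add: Suc)
  qed (use assms in simp)
  then have "real (2 ^ i) \<le> real (2 * m)" by (rule of_nat_mono)
  then have "1 / real m \<le> 2 / 2 ^ i * of_bool (m \<le> 2 ^ i)"
    using \<open>m \<le> 2 ^ i\<close> \<open>0 < m\<close> by (simp add: field_simps)
  also have "\<dots> \<le> (\<Sum>j\<le>J. 2 / 2 ^ j * of_bool (m \<le> 2 ^ j))"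
    using \<open>i \<le> J\<close> by (intro member_le_sum) auto
  finally show ?thesis .
qed

text \<open>With quadratically many \<open>x\<close> below each threshold \<open>2 ^ j\<close>, the dyadic levels contribute a
  geometric series of ratio \<open>2\<close>, dominated by the top level \<open>J\<close>.\<close>
lemma sum_inverse_le:
  fixes w :: "'a \<Rightarrow> nat"
  assumes "finite A" and w: "\<And>x. x \<in> A \<Longrightarrow> 0 < w x \<and> w x \<le> 2 ^ J"
    and count: "\<And>j. j \<le> J \<Longrightarrow> real (card {x \<in> A. w x \<le> 2 ^ j}) \<le> c * 4 ^ j"
    and "c \<ge> 0"
  shows "(\<Sum>x\<in>A. 1 / real (w x)) \<le> 4 * c * 2 ^ J"
proof -
  have "(\<Sum>x\<in>A. 1 / real (w x)) \<le> (\<Sum>x\<in>A. \<Sum>j\<le>J. 2 / 2 ^ j * of_bool (w x \<le> 2 ^ j))"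
    using w by (intro sum_mono inverse_le_dyadic_sum) auto
  also have "\<dots> = (\<Sum>j\<le>J. \<Sum>x\<in>A. 2 / 2 ^ j * of_bool (w x \<le> 2 ^ j))"
    by (rule sum.swap)
  also have "\<dots> = (\<Sum>j\<le>J. 2 / 2 ^ j * real (card {x \<in> A. w x \<le> 2 ^ j}))"
    using \<open>finite A\<close> by (simp only: sum_of_bool_eq Int_def flip: sum_distrib_left) simp
  also have "\<dots> \<le> (\<Sum>j\<le>J. 2 / 2 ^ j * (c * 4 ^ j))"
    using count by (intro sum_mono mult_left_mono) auto
  also have "\<dots> = (\<Sum>j\<le>J. 2 * c * 2 ^ j)"
  proof (intro sum.cong refl)
    fix j :: nat
    have "(4::real) ^ j = 2 ^ j * 2 ^ j" by (simp flip: power_mult_distrib)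
    then show "2 / 2 ^ j * (c * 4 ^ j) = 2 * c * 2 ^ j" by simp
  qed
  also have "\<dots> = 2 * c * (2 ^ Suc J - 1)"
    by (simp add: sum_power2 atLeast0AtMost[symmetric] sum_gp flip: sum_distrib_left)
  also have "\<dots> \<le> 4 * c * 2 ^ J"
    using \<open>c \<ge> 0\<close> by (simp add: algebra_simps)
  finally show ?thesis .
qed

text \<open>Jensen's inequality for the logarithm, by comparison with its tangent at the mean.\<close>
lemma sum_log_le_log_mean:
  fixes x :: "'a \<Rightarrow> real"
  assumes "finite A" "A \<noteq> {}" and pos: "\<And>i. i \<in> A \<Longrightarrow> x i > 0"
  shows "(\<Sum>i\<in>A. log 2 (x i)) / card A \<le> log 2 ((\<Sum>i\<in>A. x i) / card A)"
proof -
  define \<mu> where "\<mu> = (\<Sum>i\<in>A. x i) / card A"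
  have card: "real (card A) > 0" using assms by (simp add: card_gt_0_iff)
  have "\<mu> > 0" unfolding \<mu>_def using assms card by (intro divide_pos_pos sum_pos) auto
  have "(\<Sum>i\<in>A. ln (x i)) \<le> (\<Sum>i\<in>A. ln \<mu> + (x i / \<mu> - 1))"
  proof (rule sum_mono)
    fix i assume "i \<in> A"
    then show "ln (x i) \<le> ln \<mu> + (x i / \<mu> - 1)"
      using pos[of i] \<open>\<mu> > 0\<close> ln_le_minus_one[of "x i / \<mu>"] by (simp add: ln_div)
  qed
  also have "\<dots> = card A * ln \<mu> + ((\<Sum>i\<in>A. x i) / \<mu> - card A)"
    by (simp add: sum.distrib sum_subtractf sum_divide_distrib)
  also have "(\<Sum>i\<in>A. x i) = card A * \<mu>" using card by (simp add: \<mu>_def)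
  finally have "(\<Sum>i\<in>A. ln (x i)) \<le> card A * ln \<mu>" using \<open>\<mu> > 0\<close> by simp
  then have "(\<Sum>i\<in>A. ln (x i)) / ln 2 / card A \<le> ln \<mu> / ln 2"
    using card by (simp add: field_simps)
  then show ?thesis
    by (simp add: log_def sum_divide_distrib \<mu>_def)
qed

section \<open>The expected values\<close>

context
  fixes N J :: nat and m :: "int list \<Rightarrow> nat"
  assumes N: "N \<ge> 2"
  defines "J \<equiv> (N + 1) div 2"
  defines "m \<equiv> \<lambda>s. shortest_relation N (seq_value s)"
begin

text \<open>\<open>2 ^ J\<close> is the smallest power of two that is at least \<open>2 ^ (N / 2)\<close>. The strict inequality
  \<open>J < N\<close>, which keeps all thresholds \<open>2 ^ j\<close> below \<open>2 ^ N\<close>, fails for \<open>N = 1\<close>.\<close>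
lemma half_length: "J < N" "N \<le> 2 * J" "2 * J \<le> N + 1"
  using N by (auto simp: J_def)

lemma shortest_relation_bounds: "0 < m s" "m s \<le> 2 ^ J"
proof -
  show "0 < m s" by (simp add: m_def shortest_relation_pos)
  have "(2::int) ^ N \<le> 2 ^ (2 * J)" using half_length by (intro power_increasing) auto
  also have "\<dots> = (2 ^ J)\<^sup>2" by (simp add: power_mult mult.commute flip: power_mult)
  also have "\<dots> < (2 ^ J + 1)\<^sup>2" by (intro power_strict_mono) auto
  finally have "int (m s) \<le> 2 ^ J"
    unfolding m_def using half_length by (intro shortest_relation_le_of_square) auto
  then show "m s \<le> 2 ^ J" by (metis of_nat_le_iff of_nat_numeral of_nat_power)
qed

lemma sum_inverse_shortest_relation: "(\<Sum>s\<in>binary_seqs N. 1 / real (m s)) \<le> 12 * 2 ^ J"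
proof -
  have "real (card {s \<in> binary_seqs N. m s \<le> 2 ^ j}) \<le> 3 * 4 ^ j" if "j \<le> J" for j
  proof -
    have "(2::nat) ^ j < 2 ^ N" using that half_length by (intro power_strict_increasing) auto
    then have "card {s \<in> binary_seqs N. m s \<le> 2 ^ j} \<le> 3 * (2 ^ j)\<^sup>2"
      unfolding m_def by (rule card_binary_seqs_shortest_relation_le)
    also have "\<dots> = 3 * 4 ^ j" by (simp add: power2_eq_square flip: power_mult_distrib)
    finally have "real (card {s \<in> binary_seqs N. m s \<le> 2 ^ j}) \<le> real (3 * 4 ^ j)"
      by (rule of_nat_mono)
    then show ?thesis by simp
  qed
  then show ?thesis
    using sum_inverse_le[of "binary_seqs N" m J 3] finite_binary_seqs shortest_relation_bounds
    by simp
qed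

lemma rational_complexity_bounds:
  assumes "s \<in> binary_seqs N"
  shows "real (m s) \<le> rational_complexity s"
    and "rational_complexity s \<le> 2 ^ N * (1 / real (m s)) + 2 ^ J"
proof -
  have len: "length s = N" using assms by (simp add: binary_seqs_def)
  show "real (m s) \<le> rational_complexity s"
    using shortest_relation_le_rational_complexity[of s] by (simp add: m_def len)
  have "int (rational_complexity s) * int (m s) \<le> 2 ^ N + (int (m s))\<^sup>2"
    using rational_complexity_times_shortest_relation[of s] by (simp add: m_def len)
  then have "real_of_int (int (rational_complexity s) * int (m s))
      \<le> real_of_int (2 ^ N + (int (m s))\<^sup>2)"
    by (simp only: of_int_le_iff)
  then have "real (rational_complexity s) \<le> 2 ^ N * (1 / real (m s)) + real (m s)"
    using shortest_relation_bounds(1)[of s] by (simp add: field_simps power2_eq_square)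
  moreover have "real (m s) \<le> real (2 ^ J)"
    using shortest_relation_bounds(2) by (rule of_nat_mono)
  ultimately show "rational_complexity s \<le> 2 ^ N * (1 / real (m s)) + 2 ^ J"
    unfolding of_nat_power of_nat_numeral by linarith
qed

lemma expected_rational_le: "expected_rational N \<le> 2 powr (real N / 2 + 5)"
proof -
  have "(\<Sum>s\<in>binary_seqs N. real (rational_complexity s))
      \<le> (\<Sum>s\<in>binary_seqs N. 2 ^ N * (1 / real (m s)) + 2 ^ J)"
    using rational_complexity_bounds by (intro sum_mono) auto
  also have "\<dots> = 2 ^ N * (\<Sum>s\<in>binary_seqs N. 1 / real (m s)) + 2 ^ N * 2 ^ J"
    by (simp add: sum.distrib card_binary_seqs sum_distrib_left)
  also have "\<dots> \<le> 2 ^ N * (12 * 2 ^ J) + 2 ^ N * 2 ^ J"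
    using sum_inverse_shortest_relation by simp
  finally have "expected_rational N \<le> 13 * 2 ^ J"
    by (simp add: expected_rational_def field_simps)
  also have "\<dots> \<le> 2 ^ (J + 4)" by (simp add: power_add)
  also have "\<dots> = 2 powr real (J + 4)" by (subst powr_realpow) auto
  also have "\<dots> \<le> 2 powr (real N / 2 + 5)"
    using half_length by (intro powr_mono) auto
  finally show ?thesis .
qed

text \<open>Jensen's inequality is applied to \<open>1 / m\<close>, so that the upper bound for the mean of \<open>1 / m\<close>
  becomes a lower bound for the mean of \<open>log m \<le> log \<Lambda>\<close>.\<close>
lemma expected_two_adic_ge: "real N / 2 - 5 \<le> expected_two_adic N"
proof -
  let ?B = "binary_seqs N"
  have ne: "finite ?B" "?B \<noteq> {}" "real (card ?B) = 2 ^ N"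
    using card_binary_seqs[of N] by (auto simp: finite_binary_seqs)
  have pos: "0 < (\<Sum>s\<in>?B. 1 / real (m s)) / 2 ^ N"
    using ne shortest_relation_bounds by (intro divide_pos_pos sum_pos) auto
  have "- expected_two_adic N \<le> - ((\<Sum>s\<in>?B. log 2 (real (m s))) / 2 ^ N)"
    unfolding expected_two_adic_def two_adic_complexity_def
    using rational_complexity_bounds(1) shortest_relation_bounds(1)
    by (auto intro!: sum_mono divide_right_mono simp: log_mono)
  also have "\<dots> = (\<Sum>s\<in>?B. log 2 (1 / real (m s))) / card ?B"
    using ne shortest_relation_bounds(1) by (simp add: log_divide sum_negf)
  also have "\<dots> \<le> log 2 ((\<Sum>s\<in>?B. 1 / real (m s)) / 2 ^ N)"
    using sum_log_le_log_mean[of ?B "\<lambda>s. 1 / real (m s)"] ne shortest_relation_bounds(1) by simp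
  also have "\<dots> \<le> log 2 (2 powr (real J + 4 - real N))"
  proof (rule log_mono)
    have "(\<Sum>s\<in>?B. 1 / real (m s)) / 2 ^ N \<le> 16 * 2 ^ J / 2 ^ N"
      by (intro divide_right_mono order_trans[OF sum_inverse_shortest_relation]) auto
    also have "\<dots> = 2 powr (real J + 4 - real N)"
      by (simp add: powr_add powr_diff powr_realpow)
    finally show "(\<Sum>s\<in>?B. 1 / real (m s)) / 2 ^ N \<le> 2 powr (real J + 4 - real N)" .
  qed (use pos in auto)
  also have "\<dots> = real J + 4 - real N" by simp
  finally show ?thesis using half_length by linarith
qed

lemma expected_two_adic_le_log: "expected_two_adic N \<le> log 2 (expected_rational N)"
  and expected_rational_pos: "expected_rational N > 0"
proof -
  let ?B = "binary_seqs N"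
  have ne: "finite ?B" "?B \<noteq> {}" "real (card ?B) = 2 ^ N"
    using card_binary_seqs[of N] by (auto simp: finite_binary_seqs)
  have pos: "real (rational_complexity s) > 0" if "s \<in> ?B" for s
    using rational_complexity_bounds(1)[OF that] shortest_relation_bounds(1)[of s] by linarith
  show "expected_two_adic N \<le> log 2 (expected_rational N)"
    using sum_log_le_log_mean[OF ne(1,2) pos] ne(3)
    by (simp add: expected_two_adic_def expected_rational_def two_adic_complexity_def)
  show "expected_rational N > 0"
    unfolding expected_rational_def using ne pos by (intro mult_pos_pos sum_pos) auto
qed

end

theorem theorem1:
  shows "\<exists>C::real. C > 0 \<and> (\<forall>N::nat. N \<ge> 2 \<longrightarrow>
           2 powr (real N / 2 - C * (real N / ln (real N))) \<le> expected_rational N \<and>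
           expected_rational N \<le> 2 powr (real N / 2 + C * (real N / ln (real N))) \<and>
           \<bar>expected_two_adic N - real N / 2\<bar> \<le> C * ln (real N))"
proof (intro exI[of _ 10] conjI allI impI)
  fix N :: nat
  assume N: "N \<ge> 2"
  let ?R = "expected_rational N" and ?T = "expected_two_adic N"
  have T_le: "?T \<le> log 2 ?R" and R_pos: "?R > 0"
    and T_ge: "real N / 2 - 5 \<le> ?T" and R_le: "?R \<le> 2 powr (real N / 2 + 5)"
    using N expected_two_adic_le_log expected_rational_pos expected_two_adic_ge
      expected_rational_le by auto
  \<comment> \<open>For \<open>N \<ge> 2\<close> both \<open>10 ln N\<close> and \<open>10 N / ln N\<close> are at least the additive error \<open>5\<close>.\<close>
  have "1 / 2 \<le> ln (2::real)"
    using ln_le_minus_one[of "1 / 2 :: real"] by (simp add: ln_div)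
  also have "\<dots> \<le> ln (real N)" using N by simp
  finally have ln_ge: "1 / 2 \<le> ln (real N)" .
  have "ln (real N) \<le> real N" using N ln_le_minus_one[of "real N"] by simp
  then have "real N / ln (real N) \<ge> 1" using N ln_ge by (simp add: le_divide_eq)
  then have five_le: "5 \<le> 10 * (real N / ln (real N))" by linarith
  have "2 powr (real N / 2 - 10 * (real N / ln (real N))) \<le> 2 powr (log 2 ?R)"
    using five_le T_ge T_le by (intro powr_mono) linarith+
  then show "2 powr (real N / 2 - 10 * (real N / ln (real N))) \<le> ?R"
    using R_pos by simp
  have "2 powr (real N / 2 + 5) \<le> 2 powr (real N / 2 + 10 * (real N / ln (real N)))"
    using five_le by (intro powr_mono) linarith+
  then show "?R \<le> 2 powr (real N / 2 + 10 * (real N / ln (real N)))"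
    using R_le by linarith
  have "log 2 ?R \<le> log 2 (2 powr (real N / 2 + 5))"
    using R_pos R_le by (intro log_mono) auto
  then have "?T \<le> real N / 2 + 5" using T_le by simp
  then show "\<bar>?T - real N / 2\<bar> \<le> 10 * ln (real N)"
    using T_ge ln_ge by linarith
qed simp

end
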